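(* For every fixed integer $n \ge 1$, the solution space (over $\mathbb{C}$) of the system of linear equations $$Y_{n,i} = \sum_{j=i}^{n-1} \binom{3n-i-2}{j-i} (-1)^{j+n+1} Y_{n,j}, \qquad i=-n,-n+1,\ldots,n-1,$$ $$Y_{n,i} = Y_{n,-i-1}, \qquad i=-n,-n+1,\ldots,n-1,$$ in the variables $(Y_{n,i})_{-n \le i \le n-1}$ is one-dimensional.
   Context: Binomial coefficients are defined for $x\in\mathbb{C}$, $j\in\mathbb{Z}$ by $\binom{x}{j} = \frac{x(x-1)\cdots(x-j+1)}{j!}$ if $j\ge 0$ and $\binom{x}{j}=0$ if $j<0$. *)

theory Defs
  imports Complex_Main "HOL-Library.Function_Algebras"
begin

definition binom :: "complex \<Rightarrow> int \<Rightarrow> complex" where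
  "binom x j = (if j \<ge> 0 then x gchoose nat j else 0)"

definition cscale :: "complex \<Rightarrow> (int \<Rightarrow> complex) \<Rightarrow> int \<Rightarrow> complex" where
  "cscale c Y = (\<lambda>i. c * Y i)"

global_interpretation cfun: vector_space cscale
  by standard (auto simp: cscale_def fun_eq_iff algebra_simps)

text \<open>A vector \<open>(Y\<^sub>i)\<close> with \<open>- n \<le> i \<le> n - 1\<close> is represented by its extension by zero to all
  integers, so that the vectors form a space isomorphic to the functions on \<open>{- n..n - 1}\<close>.\<close>

definition solution_space :: "int \<Rightarrow> (int \<Rightarrow> complex) set" where
  "solution_space n =
     {Y. (\<forall>i. i \<notin> {- n..n - 1} \<longrightarrow> Y i = 0) \<and>
         (\<forall>i\<in>{- n..n - 1}.
            Y i = (\<Sum>j=i..n - 1. binom (of_int (3 * n - i - 2)) (j - i) * (- 1) powi (j + n + 1) * Y j)) \<and>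
         (\<forall>i\<in>{- n..n - 1}. Y i = Y (- i - 1))}"

lemma subspace_solution_space: "cfun.subspace (solution_space n)"
proof -
  define a where
    "a i j = binom (of_int (3 * n - i - 2)) (j - i) * (- 1) powi (j + n + 1)" for i j
  define T where "T Y i = (\<Sum>j=i..n - 1. a i j * Y j)" for Y i
  define R where "R Y i = Y (- i - 1)" for Y :: "int \<Rightarrow> complex" and i
  have S: "solution_space n = {Y. \<forall>i. i \<notin> {- n..n - 1} \<longrightarrow> Y i = 0} \<inter>
      ({Y. \<forall>i\<in>{- n..n - 1}. Y i = T Y i} \<inter> {Y. \<forall>i\<in>{- n..n - 1}. Y i = R Y i})"
    unfolding solution_space_def T_def a_def R_def by blast
  have lin: "T 0 i = 0" "T (Y + Z) i = T Y i + T Z i" "T (cscale c Y) i = c * T Y i"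
    "R 0 i = 0" "R (Y + Z) i = R Y i + R Z i" "R (cscale c Y) i = c * R Y i" for Y Z c i
    by (simp_all add: T_def R_def cscale_def distrib_left sum.distrib sum_distrib_left
        mult.left_commute)
  have pt: "(Y + Z) i = Y i + Z i" "cscale c Y i = c * Y i"
    for Y Z :: "int \<Rightarrow> complex" and c i
    by (simp_all add: cscale_def)
  show ?thesis
    unfolding S
    by (intro cfun.subspace_inter; simp add: cfun.subspace_def lin pt del: plus_fun_apply)
qed

end

(* Put N = 2 n and shift the indices to 0..N - 1.
   Existence: the product of the binomial coefficients (N - 1 + k choose N - 1) and
   (2 N - 2 - k choose N - 1) is a solution with nonzero entry at k = 0.
   Uniqueness: a solution u with u 0 = 0 also vanishes at N - 1 by symmetry. Substituting the
   symmetry into the first system shows that the remaining entries form a fixed vector of a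
   matrix which the unitriangular matrix ((-1)^(i + k) (N choose k - i)) conjugates to minus
   Andrews' matrix (i + l choose l - 1). That matrix is similar to a product of a positive
   diagonal matrix and the Hankel matrix of the factorials (i + l)!, which is positive
   semidefinite because (i + l)! = i! l! (sum over k of (i choose k) (l choose k)).
   So -1 is not an eigenvalue of it, and u = 0. *)

theory Submission
  imports Defs "HOL-Computational_Algebra.Formal_Power_Series"
begin

section \<open>Alternating binomial sums\<close>

lemma gbinomial_minus_of_nat:
  "(- of_nat (c + 1) :: 'a :: field_char_0) gchoose k = (- 1) ^ k * of_nat (c + k choose k)"
proof -
  have "of_nat (c + 1) + of_nat k - 1 = (of_nat (c + k) :: 'a)"
    by simp
  then show ?thesis
    by (simp only: gbinomial_minus binomial_gbinomial)
qed

text \<open>Vandermonde's convolution with upper arguments \<open>- (c + 1)\<close> and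
  \<open>a\<close>; negating the first one produces the signs. Both matrix products below and the
  existence proof reduce to this sum.\<close>

lemma alternating_Vandermonde:
  fixes a c :: nat
  shows "(\<Sum>m\<le>q. (- 1) ^ m * of_nat (c + m choose m) * of_nat (a choose (q - m))) =
    (of_nat a - of_nat c - 1 :: 'a :: field_char_0) gchoose q"
proof -
  have "- of_nat (c + 1) + of_nat a = (of_nat a - of_nat c - 1 :: 'a)"
    by simp
  then show ?thesis
    using gbinomial_Vandermonde[of "- of_nat (c + 1) :: 'a" "of_nat a" q]
    by (simp only: gbinomial_minus_of_nat atMost_atLeast0 flip: binomial_gbinomial)
qed

text \<open>An entry of R B, where R is the unitriangular matrix
  \<open>(- 1) ^ (i + k) * (M + 2 choose (k - i))\<close> and B the unsigned matrix of the folded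
  system. Reversing the summation gives an alternating Vandermonde sum with difference
  \<open>- j\<close>, and negating the upper argument again removes the sign.\<close>

lemma sum_binomial_weighted:
  fixes M i j :: nat
  assumes "1 \<le> i" "i \<le> M" "1 \<le> j"
  shows "(\<Sum>k=i..M. (- 1) ^ (i + k) * of_nat (M + 2 choose (k - i)) *
      (if k + j \<le> M + 1 then of_nat (2 * M + 2 - k choose (M + 1 - j - k)) else 0)) =
    (of_nat (M - i choose (j - 1)) :: 'a :: field_char_0)"
proof (cases "i + j \<le> M + 1")
  case False
  then show ?thesis
    using assms by (simp add: binomial_eq_0)
next
  case True
  \<comment> \<open>The largest offset \<open>k - i\<close> at which the conditional is not
    zero.\<close>
  define q where "q = M + 1 - i - j"
  let ?f = "\<lambda>k. (- 1) ^ (i + k) * of_nat (M + 2 choose (k - i)) *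
      (if k + j \<le> M + 1 then of_nat (2 * M + 2 - k choose (M + 1 - j - k)) else 0) :: 'a"
  have "(\<Sum>k=i..M. ?f k) = (\<Sum>k=i..i + q. ?f k)"
    using assms True by (intro sum.mono_neutral_right) (auto simp: q_def)
  also have "\<dots> = (\<Sum>m\<le>q. ?f (i + (q - m)))"
    by (rule sum.reindex_bij_witness[of _ "\<lambda>m. i + (q - m)" "\<lambda>k. i + q - k"]) auto
  also have "\<dots> = (\<Sum>m\<le>q. (- 1) ^ q *
      ((- 1) ^ m * of_nat (M + 1 + j + m choose m) * of_nat (M + 2 choose (q - m))))"
  proof (rule sum.cong[OF refl])
    fix m assume "m \<in> {..q}"
    then have m: "m \<le> q" by simp
    have s: "(- 1 :: 'a) ^ (i + (i + (q - m))) = (- 1) ^ q * (- 1) ^ m"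
      using m by (simp add: minus_one_power_iff)
    have e: "2 * M + 2 - (i + (q - m)) = M + 1 + j + m" "M + 1 - j - (i + (q - m)) = m"
      using m True assms by (auto simp: q_def)
    have g: "i + (q - m) + j \<le> M + 1"
      using m True by (auto simp: q_def)
    show "?f (i + (q - m)) = (- 1) ^ q *
      ((- 1) ^ m * of_nat (M + 1 + j + m choose m) * of_nat (M + 2 choose (q - m)))"
      unfolding s e if_P[OF g] by simp
  qed
  also have "\<dots> = (- 1) ^ q * ((of_nat (M + 2) - of_nat (M + 1 + j) - 1 :: 'a) gchoose q)"
    by (simp only: alternating_Vandermonde flip: sum_distrib_left)
  also have "of_nat (M + 2) - of_nat (M + 1 + j) - 1 = (- of_nat j :: 'a)"
    by simp
  also have "(- 1) ^ q * ((- of_nat j :: 'a) gchoose q) = of_nat (j + q - 1 choose q)"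
    using assms by (simp add: gbinomial_minus binomial_gbinomial of_nat_diff flip: power_add)
  also have "j + q - 1 choose q = M - i choose (j - 1)"
    using True assms by (subst binomial_symmetric) (auto simp: q_def)
  finally show ?thesis .
qed

text \<open>An entry of A R with Andrews' matrix A; again alternating Vandermonde, now with
  \<open>m = l - 1\<close>. Comparison with the entries of R B gives R B D = - A R for the diagonal
  matrix D of the signs \<open>(- 1) ^ j\<close>.\<close>

lemma sum_binomial_Andrews:
  fixes M i j :: nat
  assumes "i \<le> M" "1 \<le> j" "j \<le> M"
  shows "(\<Sum>l=1..j. of_nat (i + l choose (l - 1)) *
      ((- 1) ^ (l + j) * of_nat (M + 2 choose (j - l)))) =
    (- 1) ^ (j + 1) * (of_nat (M - i choose (j - 1)) :: 'a :: field_char_0)"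
proof -
  have "(\<Sum>l=1..j. of_nat (i + l choose (l - 1)) *
      ((- 1) ^ (l + j) * of_nat (M + 2 choose (j - l)))) =
    (\<Sum>m\<le>j - 1. of_nat (i + (m + 1) choose m) *
      ((- 1) ^ (m + 1 + j) * of_nat (M + 2 choose (j - (m + 1)))) :: 'a)"
    using assms
    by (intro sum.reindex_bij_witness[of _ "\<lambda>m. m + 1" "\<lambda>l. l - 1"]) auto
  also have "\<dots> = (- 1) ^ (j + 1) * (\<Sum>m\<le>j - 1. (- 1) ^ m * of_nat (i + 1 + m choose m) *
      of_nat (M + 2 choose (j - 1 - m)))"
    by (simp add: sum_distrib_left power_add algebra_simps)
  also have "\<dots> = (- 1) ^ (j + 1) * (of_nat (M - i) gchoose (j - 1))"
    unfolding alternating_Vandermonde using assms by (simp add: of_nat_diff algebra_simps)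
  finally show ?thesis
    by (simp add: binomial_gbinomial)
qed

section \<open>Positivity of the factorial Hankel matrix and Andrews' matrix\<close>

text \<open>Vandermonde's identity for \<open>i + j choose i\<close>, read as a Gram factorization
  of the Hankel matrix. The common bound \<open>M\<close> makes the range of \<open>k\<close>
  independent of \<open>i\<close>, so that the sums can be swapped later.\<close>

lemma fact_add_sum:
  assumes "i \<le> M"
  shows "(fact (i + j) :: 'a :: field_char_0) =
    (\<Sum>k\<le>M. (fact i * of_nat (i choose k)) * (fact j * of_nat (j choose k)))"
proof -
  have "(\<Sum>k\<le>M. (i choose k) * (j choose k)) = (\<Sum>k\<le>i. (i choose k) * (j choose k))"
    using assms by (intro sum.mono_neutral_right) auto
  also have "\<dots> = (\<Sum>k\<le>i. (j choose k) * (i choose (i - k)))"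
    by (intro sum.cong) (simp_all add: binomial_symmetric[symmetric])
  also have "\<dots> = i + j choose i"
    using vandermonde[of j i i] by (simp add: add.commute)
  finally have "of_nat (i + j choose i) = (\<Sum>k\<le>M. of_nat (i choose k) * of_nat (j choose k) :: 'a)"
    by (metis (no_types, lifting) of_nat_mult of_nat_sum sum.cong)
  moreover have "(fact (i + j) :: 'a) = fact i * fact j * of_nat (i + j choose i)"
    by (simp add: binomial_fact)
  ultimately show ?thesis
    by (simp add: sum_distrib_left algebra_simps)
qed

lemma Andrews_matrix_no_eigenvalue:
  fixes w :: "nat \<Rightarrow> complex"
  assumes w: "\<And>i. i \<in> {1..M} \<Longrightarrow> w i = - (\<Sum>l=1..M. of_nat (i + l choose (l - 1)) * w l)"
    and i: "i \<in> {1..M}"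
  shows "w i = 0"
proof -
  \<comment> \<open>Since \<open>l + m choose (m - 1)\<close> is (l + m)! / ((l + 1)! (m - 1)!),
    this scaling and multiplication of row \<open>l\<close> by (l + 1)! leave the Hankel matrix on
    the right.\<close>
  define x where "x l = w l / fact (l - 1)" for l
  define S where "S k = (\<Sum>l=1..M. fact l * of_nat (l choose k) * x l)" for k
  have eq: "fact (l + 1) * fact (l - 1) * x l = - (\<Sum>m=1..M. fact (l + m) * x m)"
    if l: "l \<in> {1..M}" for l
  proof -
    have "fact (l + 1) * (of_nat (l + m choose (m - 1)) * w m) = fact (l + m) * x m"
      if "m \<in> {1..M}" for m
      using that by (simp add: x_def binomial_fact Suc_diff_le del: fact_Suc)
    then have "(\<Sum>m=1..M. fact (l + 1) * (of_nat (l + m choose (m - 1)) * w m)) =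
        (\<Sum>m=1..M. fact (l + m) * x m)"
      by (rule sum.cong[OF refl])
    moreover have "fact (l + 1) * w l =
        - (\<Sum>m=1..M. fact (l + 1) * (of_nat (l + m choose (m - 1)) * w m))"
      by (subst w[OF l]) (simp only: sum_distrib_left mult_minus_right)
    moreover have "fact (l - 1) * x l = w l"
      by (simp add: x_def)
    ultimately show ?thesis
      by (metis mult.assoc)
  qed
  \<comment> \<open>Pairing the equations with the conjugate of \<open>x\<close> equates a positive
    definite form with minus a sum of squared norms, so both vanish.\<close>
  have "(\<Sum>l=1..M. fact (l + 1) * fact (l - 1) * (x l * cnj (x l))) =
      (\<Sum>l=1..M. cnj (x l) * (fact (l + 1) * fact (l - 1) * x l))"
    by (simp add: algebra_simps)
  also have "\<dots> = (\<Sum>l=1..M. cnj (x l) * - (\<Sum>m=1..M. fact (l + m) * x m))"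
    by (intro sum.cong refl arg_cong2[of _ _ _ _ "(*)"] eq)
  also have "\<dots> = - (\<Sum>l=1..M. \<Sum>m=1..M. \<Sum>k\<le>M.
      (fact l * of_nat (l choose k) * cnj (x l)) * (fact m * of_nat (m choose k) * x m))"
    unfolding mult_minus_right sum_negf sum_distrib_left
    by (intro arg_cong[of _ _ uminus] sum.cong refl)
      (simp add: fact_add_sum[where M = M] sum_distrib_left sum_distrib_right mult_ac)
  also have "\<dots> = - (\<Sum>k\<le>M. \<Sum>l=1..M. \<Sum>m=1..M.
      (fact l * of_nat (l choose k) * cnj (x l)) * (fact m * of_nat (m choose k) * x m))"
    by (subst sum.swap[of _ "{..M}"]) (simp add: sum.swap[of _ "{..M}"])
  also have "\<dots> = - (\<Sum>k\<le>M. cnj (S k) * S k)"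
    by (simp add: S_def sum_product)
  finally have "(\<Sum>l=1..M. of_real (fact (l + 1) * fact (l - 1) * (cmod (x l))\<^sup>2)) =
      (of_real (- (\<Sum>k\<le>M. (cmod (S k))\<^sup>2)) :: complex)"
    by (simp only: complex_norm_square of_real_mult of_real_fact of_real_sum of_real_minus
        mult.commute[of "cnj _"])
  then have "(\<Sum>l=1..M. fact (l + 1) * fact (l - 1) * (cmod (x l))\<^sup>2) = - (\<Sum>k\<le>M. (cmod (S k))\<^sup>2)"
    by (simp only: of_real_eq_iff flip: of_real_sum)
  moreover have "(\<Sum>k\<le>M. (cmod (S k))\<^sup>2) \<ge> 0"
    by (intro sum_nonneg) simp
  moreover have "(\<Sum>l=1..M. fact (l + 1) * fact (l - 1) * (cmod (x l))\<^sup>2) \<ge> 0"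
    by (intro sum_nonneg) simp
  ultimately have "(\<Sum>l=1..M. fact (l + 1) * fact (l - 1) * (cmod (x l))\<^sup>2) = 0"
    by linarith
  then have "fact (i + 1) * fact (i - 1) * (cmod (x i))\<^sup>2 = 0"
    using i by (subst (asm) sum_nonneg_eq_0_iff) auto
  then show ?thesis
    by (simp add: x_def)
qed

section \<open>Uniqueness for the shifted system\<close>

lemma folded_system_trivial:
  fixes u :: "nat \<Rightarrow> complex"
  assumes u: "\<And>k. k \<in> {1..M} \<Longrightarrow> u k = (\<Sum>j=1..M. (- 1) ^ j *
      (if k + j \<le> M + 1 then of_nat (2 * M + 2 - k choose (M + 1 - j - k)) else 0) * u j)"
    and k: "k \<in> {1..M}"
  shows "u k = 0"
proof -
  define w where "w i = (\<Sum>k=i..M. (- 1) ^ (i + k) * of_nat (M + 2 choose (k - i)) * u k)" for i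
  have "w i = - (\<Sum>l=1..M. of_nat (i + l choose (l - 1)) * w l)" if i: "i \<in> {1..M}" for i
  proof -
    let ?b = "\<lambda>k j. if k + j \<le> M + 1 then of_nat (2 * M + 2 - k choose (M + 1 - j - k)) else 0 :: complex"
    let ?r = "\<lambda>i k. (- 1) ^ (i + k) * of_nat (M + 2 choose (k - i)) :: complex"
    have "w i = (\<Sum>k=i..M. ?r i k * (\<Sum>j=1..M. (- 1) ^ j * ?b k j * u j))"
      unfolding w_def using i by (intro sum.cong refl arg_cong2[of _ _ _ _ "(*)"] u) auto
    also have "\<dots> = (\<Sum>k=i..M. \<Sum>j=1..M. (- 1) ^ j * u j * (?r i k * ?b k j))"
      unfolding sum_distrib_left by (intro sum.cong refl) (simp only: mult_ac)
    also have "\<dots> = (\<Sum>j=1..M. (- 1) ^ j * u j * (\<Sum>k=i..M. ?r i k * ?b k j))"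
      by (subst sum.swap) (simp only: sum_distrib_left)
    also have "\<dots> = (\<Sum>j=1..M. (- 1) ^ j * u j * of_nat (M - i choose (j - 1)))"
      using i by (intro sum.cong refl arg_cong2[of _ _ _ _ "(*)"] sum_binomial_weighted) auto
    also have "\<dots> = - (\<Sum>j=1..M. u j * ((- 1) ^ (j + 1) * of_nat (M - i choose (j - 1))))"
      by (simp add: sum_negf algebra_simps)
    \<comment> \<open>The common value \<open>M - i choose (j - 1)\<close> is re-expanded as an
      entry of A R, which turns R B D \<open>u\<close> into - A \<open>w\<close>.\<close>
    also have "\<dots> = - (\<Sum>j=1..M. u j * (\<Sum>l=1..j. of_nat (i + l choose (l - 1)) * ?r l j))"
      using i sum_binomial_Andrews[of i M, where 'a = complex]
      by (intro arg_cong[of _ _ uminus] sum.cong refl arg_cong2[of _ _ _ _ "(*)"]) auto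
    also have "\<dots> = - (\<Sum>j=1..M. \<Sum>l=1..j. of_nat (i + l choose (l - 1)) * (?r l j * u j))"
      by (simp only: sum_distrib_left mult_ac)
    also have "\<dots> = - (\<Sum>l=1..M. \<Sum>j=l..M. of_nat (i + l choose (l - 1)) * (?r l j * u j))"
      unfolding sum.Sigma[OF finite_atLeastAtMost ballI[OF finite_atLeastAtMost]]
      by (intro arg_cong[of _ _ uminus]
          sum.reindex_bij_witness[of _ "\<lambda>(x, y). (y, x)" "\<lambda>(x, y). (y, x)"]) auto
    finally show ?thesis
      by (simp only: w_def sum_distrib_left)
  qed
  from Andrews_matrix_no_eigenvalue[OF this] have w0: "w i = 0" if "i \<in> {1..M}" for i
    using that by blast
  show ?thesis
    using k
  \<comment> \<open>Back-substitution from \<open>k = M\<close> downwards: the diagonal coefficients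
    of the triangular matrix are 1.\<close>
  proof (induction "M - k" arbitrary: k rule: less_induct)
    case less
    have "w k = u k + (\<Sum>j=Suc k..M. (- 1) ^ (k + j) * of_nat (M + 2 choose (j - k)) * u j)"
      unfolding w_def using less.prems by (subst sum.atLeast_Suc_atMost) (auto simp flip: mult_2)
    also have "(\<Sum>j=Suc k..M. (- 1) ^ (k + j) * of_nat (M + 2 choose (j - k)) * u j) = 0"
      using less.prems by (intro sum.neutral) (auto intro!: less.hyps)
    finally show ?case
      using w0[OF less.prems] by simp
  qed
qed

text \<open>The original system under \<open>i = k - n\<close>, \<open>j = l - n\<close>,
  \<open>N = 2 * n\<close>: then 3 n - i - 2 becomes 2 N - 2 - k, and the reflection of
  \<open>i\<close> to \<open>- i - 1\<close> becomes that of \<open>k\<close> to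
  \<open>N - 1 - k\<close>.\<close>

definition nat_solution :: "nat \<Rightarrow> (nat \<Rightarrow> complex) \<Rightarrow> bool" where
  "nat_solution N u \<longleftrightarrow> (\<forall>k<N. u k =
      (\<Sum>l=k..<N. of_nat (2 * N - 2 - k choose (l - k)) * (- 1) ^ (l + 1) * u l) \<and>
      u k = u (N - 1 - k))"

lemma nat_solution_cong:
  assumes "\<And>k. k < N \<Longrightarrow> u k = v k"
  shows "nat_solution N u \<longleftrightarrow> nat_solution N v"
proof -
  have "(\<Sum>l=k..<N. f l * u l) = (\<Sum>l=k..<N. f l * v l)" for f k
    by (intro sum.cong) (auto simp: assms)
  moreover have "u (N - 1 - k) = v (N - 1 - k)" if "k < N" for k
    using that by (intro assms) auto
  ultimately show ?thesis
    unfolding nat_solution_def by (simp only: assms cong: imp_cong)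
qed

lemma nat_solution_trivial:
  assumes sol: "nat_solution N u" and N: "even N" "N > 0" and u0: "u 0 = 0" and k: "k < N"
  shows "u k = 0"
proof -
  have eq: "u k = (\<Sum>l=k..<N. of_nat (2 * N - 2 - k choose (l - k)) * (- 1) ^ (l + 1) * u l)"
    and sym: "u k = u (N - 1 - k)" if "k < N" for k
    using sol that unfolding nat_solution_def by blast+
  \<comment> \<open>The number of entries left once the two outer ones, at 0 and
    \<open>M + 1\<close>, are known to vanish.\<close>
  define M where "M = N - 2"
  have NM: "N = M + 2"
    using N by (cases "N = 1") (auto simp: M_def)
  have evM: "even M"
    using N by (simp add: NM)
  have uM: "u (M + 1) = 0"
    using sym[of 0] u0 by (simp add: NM)
  have "u k = (\<Sum>j=1..M. (- 1) ^ j *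
      (if k + j \<le> M + 1 then of_nat (2 * M + 2 - k choose (M + 1 - j - k)) else 0) * u j)"
    if k: "k \<in> {1..M}" for k
  proof -
    let ?g = "\<lambda>j. (- 1) ^ j *
      (if k + j \<le> M + 1 then of_nat (2 * M + 2 - k choose (M + 1 - j - k)) else 0) * u j"
    have "u k = (\<Sum>l=k..<N. of_nat (2 * N - 2 - k choose (l - k)) * (- 1) ^ (l + 1) * u l)"
      using k by (intro eq) (auto simp: NM)
    \<comment> \<open>Reflecting the index keeps \<open>u\<close> by symmetry; as \<open>M\<close>
      is even, the sign at \<open>l = M + 1 - j\<close> becomes \<open>(- 1) ^ j\<close>.\<close>
    also have "\<dots> = (\<Sum>j\<in>{0..M + 1 - k}. ?g j)"
    proof (rule sum.reindex_bij_witness[of _ "\<lambda>j. M + 1 - j" "\<lambda>l. M + 1 - l"])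
      fix l assume l: "l \<in> {k..<N}"
      have ul: "u (M + 1 - l) = u l"
        using sym[of l] l by (simp add: NM)
      have sgn: "(- 1 :: complex) ^ (M + 1 - l) = (- 1) ^ (l + 1)"
        using l evM by (simp add: minus_one_power_iff NM)
      have d: "M + 1 - (M + 1 - l) - k = l - k"
        using l by (auto simp: NM)
      have g: "k + (M + 1 - l) \<le> M + 1"
        using l by (auto simp: NM)
      show "?g (M + 1 - l) =
          of_nat (2 * N - 2 - k choose (l - k)) * (- 1) ^ (l + 1) * u l"
        unfolding sgn d ul if_P[OF g] by (simp add: NM)
    qed (use k in \<open>auto simp: NM\<close>)
    also have "\<dots> = (\<Sum>j\<in>{1..M + 1 - k}. ?g j)"
      using u0 by (intro sum.mono_neutral_right) (auto simp: not_le)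
    also have "\<dots> = (\<Sum>j=1..M. ?g j)"
      using k by (intro sum.mono_neutral_left) auto
    finally show ?thesis .
  qed
  from folded_system_trivial[OF this] have "u k = 0" if "k \<in> {1..M}" for k
    using that by blast
  moreover have "k = 0 \<or> k \<in> {1..M} \<or> k = M + 1"
    using k by (auto simp: NM)
  ultimately show ?thesis
    using u0 uM by auto
qed

section \<open>Existence of a nonzero solution\<close>

text \<open>Up to a constant factor, these are the refined alternating sign matrix numbers.\<close>

definition refined_numbers :: "nat \<Rightarrow> nat \<Rightarrow> complex" where
  "refined_numbers N k = of_nat ((N - 1 + k choose (N - 1)) * (2 * N - 2 - k choose (N - 1)))"

lemma nat_solution_refined_numbers:
  assumes N: "even N" "N > 0"
  shows "nat_solution N (refined_numbers N)"
  unfolding nat_solution_def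
proof (intro allI impI conjI)
  fix k assume k: "k < N"
  \<comment> \<open>Reflecting \<open>k\<close> exchanges the two binomial factors.\<close>
  have e: "2 * N - 2 - k = N - 1 + (N - 1 - k)" "2 * N - 2 - (N - 1 - k) = N - 1 + k"
    using k by auto
  show "refined_numbers N k = refined_numbers N (N - 1 - k)"
    unfolding refined_numbers_def e by (simp add: mult.commute)
  let ?c = "of_nat (2 * N - 2 - k choose (N - 1)) :: complex"
  have term_eq: "of_nat (2 * N - 2 - k choose (l - k)) * (- 1) ^ (l + 1) * refined_numbers N l =
      - ?c * ((- 1) ^ l * of_nat (N - 1 + l choose l) * of_nat (N - 1 - k choose (N - 1 - l)))"
    if l: "l \<in> {k..<N}" for l
  proof -
    \<comment> \<open>Trinomial revision extracts a factor free of \<open>l\<close>; what remains is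
      an alternating Vandermonde sum.\<close>
    have "(2 * N - 2 - k choose (l - k)) * (2 * N - 2 - l choose (N - 1)) =
        (2 * N - 2 - k choose (N - 1)) * (N - 1 - k choose (N - 1 - l))"
    proof -
      have "2 * N - 2 - k choose (l - k) = 2 * N - 2 - k choose (2 * N - 2 - l)"
        using l by (subst binomial_symmetric) auto
      moreover have "(2 * N - 2 - k choose (2 * N - 2 - l)) * (2 * N - 2 - l choose (N - 1)) =
        (2 * N - 2 - k choose (N - 1)) *
          (2 * N - 2 - k - (N - 1) choose (2 * N - 2 - l - (N - 1)))"
        using l by (intro choose_mult) auto
      moreover have "2 * N - 2 - k - (N - 1) = N - 1 - k" "2 * N - 2 - l - (N - 1) = N - 1 - l"
        using l by auto
      ultimately show ?thesis
        by simp
    qed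
    then have "of_nat (2 * N - 2 - k choose (l - k)) * of_nat (2 * N - 2 - l choose (N - 1)) =
        ?c * of_nat (N - 1 - k choose (N - 1 - l))"
      by (metis of_nat_mult)
    moreover have "N - 1 + l choose (N - 1) = N - 1 + l choose l"
      by (subst binomial_symmetric) auto
    ultimately show ?thesis
      by (simp add: refined_numbers_def)
  qed
  have "(\<Sum>l=k..<N. of_nat (2 * N - 2 - k choose (l - k)) * (- 1) ^ (l + 1) * refined_numbers N l) =
      - ?c * (\<Sum>l=k..<N. (- 1) ^ l * of_nat (N - 1 + l choose l) *
        of_nat (N - 1 - k choose (N - 1 - l)))"
    unfolding sum_distrib_left by (rule sum.cong[OF refl term_eq])
  also have "(\<Sum>l=k..<N. (- 1) ^ l * of_nat (N - 1 + l choose l) *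
        of_nat (N - 1 - k choose (N - 1 - l))) =
      (\<Sum>l\<le>N - 1. (- 1) ^ l * of_nat (N - 1 + l choose l) *
        of_nat (N - 1 - k choose (N - 1 - l)) :: complex)"
    \<comment> \<open>For \<open>l < k\<close> the lower index \<open>N - 1 - l\<close> exceeds the
      upper index \<open>N - 1 - k\<close>.\<close>
    using k by (intro sum.mono_neutral_left) (auto simp: not_le intro!: binomial_eq_0)
  also have "\<dots> = (of_nat (N - 1 - k) - of_nat (N - 1) - 1) gchoose (N - 1)"
    by (rule alternating_Vandermonde)
  also have "(of_nat (N - 1 - k) - of_nat (N - 1) - 1 :: complex) = - of_nat (k + 1)"
    using k by (simp add: of_nat_diff)
  also have "(- of_nat (k + 1) :: complex) gchoose (N - 1) = - of_nat (N - 1 + k choose (N - 1))"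
  proof -
    have "k + (N - 1) choose (N - 1) = N - 1 + k choose (N - 1)"
      by (simp add: add.commute)
    \<comment> \<open>Evenness of \<open>N\<close> enters here: this sign cancels the one in front
      of \<open>?c\<close>.\<close>
    moreover have "(- 1 :: complex) ^ (N - 1) = - 1"
      using N by (simp add: minus_one_power_iff)
    ultimately show ?thesis
      by (simp only: gbinomial_minus_of_nat mult_minus1)
  qed
  finally show "refined_numbers N k =
      (\<Sum>l=k..<N. of_nat (2 * N - 2 - k choose (l - k)) * (- 1) ^ (l + 1) * refined_numbers N l)"
    by (simp add: refined_numbers_def mult.commute)
qed

section \<open>Transfer to the original system and the dimension\<close>

lemma solution_space_iff:
  fixes m :: nat
  shows "Y \<in> solution_space (int m) \<longleftrightarrow> (\<forall>i. i \<notin> {- int m..int m - 1} \<longrightarrow> Y i = 0) \<and>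
    nat_solution (2 * m) (\<lambda>k. Y (int k - int m))"
proof -
  let ?I = "{- int m..int m - 1}"
  have ball: "(\<forall>i\<in>?I. P i) \<longleftrightarrow> (\<forall>k<2 * m. P (int k - int m))" for P
  proof
    assume *: "\<forall>k<2 * m. P (int k - int m)"
    show "\<forall>i\<in>?I. P i"
    proof
      fix i assume "i \<in> ?I"
      then show "P i"
        using *[rule_format, of "nat (i + int m)"] by auto
    qed
  qed auto
  have sum: "(\<Sum>j=int k - int m..int m - 1.
      binom (of_int (3 * int m - (int k - int m) - 2)) (j - (int k - int m)) *
        (- 1) powi (j + int m + 1) * Y j) =
    (\<Sum>l=k..<2 * m. of_nat (2 * (2 * m) - 2 - k choose (l - k)) * (- 1) ^ (l + 1) *
      Y (int l - int m))" if k: "k < 2 * m" for k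
  proof (rule sum.reindex_bij_witness[of _ "\<lambda>l. int l - int m" "\<lambda>j. nat (j + int m)"])
    fix j assume j: "j \<in> {int k - int m..int m - 1}"
    then obtain l where l: "j = int l - int m"
      by (intro that[of "nat (j + int m)"]) auto
    \<comment> \<open>The bound on \<open>k\<close> keeps the natural subtraction from truncating,
      so the generalized binomial is an ordinary one.\<close>
    have "of_int (3 * int m - (int k - int m) - 2) = (of_nat (2 * (2 * m) - 2 - k) :: complex)"
      using k by (simp add: of_nat_diff)
    moreover have "nat (j - (int k - int m)) = l - k" "j - (int k - int m) \<ge> 0"
      using j by (auto simp: l)
    ultimately have "binom (of_int (3 * int m - (int k - int m) - 2)) (j - (int k - int m)) =
        of_nat (2 * (2 * m) - 2 - k choose (l - k))"
      by (simp only: binom_def if_True binomial_gbinomial)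
    moreover have "(- 1 :: complex) powi (j + int m + 1) = (- 1) ^ (l + 1)"
      by (metis l diff_add_cancel of_nat_1 of_nat_add power_int_of_nat)
    ultimately show "of_nat (2 * (2 * m) - 2 - k choose (nat (j + int m) - k)) *
        (- 1) ^ (nat (j + int m) + 1) * Y (int (nat (j + int m)) - int m) =
      binom (of_int (3 * int m - (int k - int m) - 2)) (j - (int k - int m)) *
        (- 1) powi (j + int m + 1) * Y j"
      by (simp add: l)
  qed auto
  have flip: "- (int k - int m) - 1 = int (2 * m - 1 - k) - int m" if "k < 2 * m" for k
    using that by auto
  show ?thesis
    unfolding solution_space_def nat_solution_def mem_Collect_eq ball
    by (simp only: sum flip all_conj_distrib imp_conjR cong: imp_cong)
qed

theorem proposition2p1:
  fixes n :: int
  assumes "n \<ge> 1"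
  shows "cfun.dim (solution_space n) = 1"
proof -
  define m where "m = nat n"
  have n: "n = int m" and m: "m > 0"
    using assms by (auto simp: m_def)
  define Z :: "int \<Rightarrow> complex" where
    "Z i = (if i \<in> {- n..n - 1} then refined_numbers (2 * m) (nat (i + n)) else 0)" for i
  have Z_nat: "Z (int k - int m) = refined_numbers (2 * m) k" if "k < 2 * m" for k
    using that by (auto simp: Z_def n)
  have "nat_solution (2 * m) (\<lambda>k. Z (int k - int m)) \<longleftrightarrow>
      nat_solution (2 * m) (refined_numbers (2 * m))"
    by (rule nat_solution_cong) (rule Z_nat)
  then have Z: "Z \<in> solution_space n"
    unfolding n solution_space_iff using m nat_solution_refined_numbers[of "2 * m"]
    by (auto simp: Z_def n)
  have Z0: "Z (- n) \<noteq> 0"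
    using Z_nat[of 0] m by (simp add: n refined_numbers_def)
  have span: "solution_space n \<subseteq> cfun.span {Z}"
  proof
    fix Y assume Y: "Y \<in> solution_space n"
    \<comment> \<open>Chosen so that \<open>D\<close> vanishes at \<open>- n\<close>, the position
      \<open>k = 0\<close> where the uniqueness result requires a zero.\<close>
    define c where "c = Y (- n) / Z (- n)"
    define D where "D = Y - cscale c Z"
    have "D \<in> solution_space n"
      unfolding D_def
      by (intro cfun.subspace_diff cfun.subspace_scale subspace_solution_space Y Z)
    then have supp: "\<And>i. i \<notin> {- int m..int m - 1} \<Longrightarrow> D i = 0"
      and sol: "nat_solution (2 * m) (\<lambda>k. D (int k - int m))"
      unfolding n solution_space_iff by blast+
    have "D (- n) = 0"
      using Z0 by (simp add: D_def cscale_def c_def)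
    then have nz: "D (int k - int m) = 0" if "k < 2 * m" for k
      using nat_solution_trivial[OF sol] m that by (simp add: n)
    have "D i = 0" for i
      using supp[of i] nz[of "nat (i + int m)"] by (cases "i \<in> {- int m..int m - 1}") auto
    then have "Y = cscale c Z"
      by (simp add: D_def fun_eq_iff)
    then show "Y \<in> cfun.span {Z}"
      by (simp add: cfun.span_scale cfun.span_base)
  qed
  have "Z \<noteq> 0"
    using Z0 by auto
  then show ?thesis
    using cfun.dim_unique[of "{Z}" "solution_space n" 1] Z span by simp
qed

end
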